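(* For every integer $n\ge1$, $$\sum_{\lambda\vdash n} f_\lambda^2\sum_{v\in\lambda}h_v^2=\frac{n(3n-1)}{2}\,n!.$$
   Context: $\lambda\vdash n$ means $\lambda$ is a partition of $n$ (weakly decreasing positive integers $\lambda_1\ge\cdots\ge\lambda_\ell$ summing to $n$). The boxes of $\lambda$ are the pairs $(i,j)$ with $1\le j\le \lambda_i$; the hook length of $v=(i,j)$ is $h_v=\lambda_i-j+\lambda'_j-i+1$ with $\lambda'_j=\#\{k:\lambda_k\ge j\}$. $f_\lambda$ is the number of standard Young tableaux of shape $\lambda$ (equivalently $f_\lambda=n!/\prod_{v\in\lambda}h_v$). *)

theory Defs
  imports Complex_Main "HOL-Library.FuncSet"
begin

text \<open>A partition is the list of its parts; parts and boxes are indexed from 1 as usual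
  in the literature, so the part \<open>\<lambda>\<^sub>i\<close> is the list entry at position \<open>i - 1\<close>.\<close>

definition is_partition :: "nat \<Rightarrow> nat list \<Rightarrow> bool" where
  "is_partition n lam \<longleftrightarrow>
     sorted_wrt (\<ge>) lam \<and> (\<forall>p \<in> set lam. p > 0) \<and> sum_list lam = n"

definition part :: "nat list \<Rightarrow> nat \<Rightarrow> nat" where
  "part lam i = lam ! (i - 1)"

definition boxes :: "nat list \<Rightarrow> (nat \<times> nat) set" where
  "boxes lam = {(i, j). 1 \<le> i \<and> i \<le> length lam \<and> 1 \<le> j \<and> j \<le> part lam i}"

definition conj_part :: "nat list \<Rightarrow> nat \<Rightarrow> nat" where
  "conj_part lam j = card {k. 1 \<le> k \<and> k \<le> length lam \<and> part lam k \<ge> j}"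

text \<open>For a box \<open>(i, j)\<close> of a partition both differences are non-negative,
  so the subtraction on natural numbers does not truncate.\<close>

definition hook :: "nat list \<Rightarrow> nat \<times> nat \<Rightarrow> nat" where
  "hook lam = (\<lambda>(i, j). (part lam i - j) + (conj_part lam j - i) + 1)"

text \<open>Tableaux are fillings of the boxes only; extensionality fixes the irrelevant values
  elsewhere, so that each tableau is counted once.\<close>

definition standard_tableaux :: "nat list \<Rightarrow> (nat \<times> nat \<Rightarrow> nat) set" where
  "standard_tableaux lam =
     {T. T \<in> extensional (boxes lam) \<and>
         bij_betw T (boxes lam) {1..sum_list lam} \<and>
         (\<forall>i j j'. (i, j) \<in> boxes lam \<and> (i, j') \<in> boxes lam \<and> j < j' \<longrightarrow> T (i, j) < T (i, j')) \<and>
         (\<forall>i i' j. (i, j) \<in> boxes lam \<and> (i', j) \<in> boxes lam \<and> i < i' \<longrightarrow> T (i, j) < T (i', j))}"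

definition num_SYT :: "nat list \<Rightarrow> nat" where
  "num_SYT lam = card (standard_tableaux lam)"

end

theory Submission
  imports Defs
begin

text \<open>Counting pairs of boxes by relative position gives
  \<open>\<Sum>\<^sub>v h\<^sub>v\<^sup>2 = n\<^sup>2 + \<Sum>\<^sub>v c\<^sub>v\<^sup>2\<close> with \<open>c\<^sub>v\<close> the content of \<open>v\<close>. So it
  suffices to average \<open>1\<close> and \<open>\<Sum>\<^sub>v c\<^sub>v\<^sup>2\<close> against \<open>f\<^sub>\<lambda>\<^sup>2\<close>, by induction on \<open>n\<close>. With
  \<open>f\<^sub>\<lambda> = \<Sum>\<^sub>\<mu> f\<^sub>\<mu>\<close> (\<open>\<mu>\<close> obtained from \<open>\<lambda>\<close> by removing a corner) this needs only
  the moments \<open>\<Sum>\<^sub>\<lambda> c\<^sup>k f\<^sub>\<lambda>\<close>, \<open>k = 0, 2\<close>, over the \<open>\<lambda>\<close> obtained from a fixed \<open>\<mu>\<close> of size \<open>n\<close>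
  by adding a box of content \<open>c\<close>; they are \<open>(n + 1) f\<^sub>\<mu>\<close> and \<open>n (n + 1) f\<^sub>\<mu>\<close>. This follows by
  commuting the addition and the removal of boxes, since the sum of \<open>c\<^sup>k\<close> over the addable
  boxes of \<open>\<mu>\<close> exceeds that over the removable ones by \<open>1\<close> and \<open>2 n\<close>, respectively.\<close>

section \<open>Young diagrams as sets of boxes\<close>

text \<open>Finite order ideals of the grid of positive pairs. With sets instead of lists of parts,
  adding and removing a box are \<open>insert\<close> and set difference, and union and intersection
  again give diagrams.\<close>

definition diagram :: "(nat \<times> nat) set \<Rightarrow> bool" where
  "diagram S \<longleftrightarrow> finite S \<and> (\<forall>i j. (i, j) \<in> S \<longrightarrow> 1 \<le> i \<and> 1 \<le> j) \<and>
     (\<forall>i j i' j'. (i, j) \<in> S \<and> 1 \<le> i' \<and> i' \<le> i \<and> 1 \<le> j' \<and> j' \<le> j \<longrightarrow> (i', j') \<in> S)"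

definition addable :: "(nat \<times> nat) set \<Rightarrow> (nat \<times> nat) set" where
  "addable S = {v. v \<notin> S \<and> diagram (insert v S)}"

definition removable :: "(nat \<times> nat) set \<Rightarrow> (nat \<times> nat) set" where
  "removable S = {v \<in> S. diagram (S - {v})}"

text \<open>Real-valued because boxes below the diagonal have negative content.\<close>

definition content :: "nat \<times> nat \<Rightarrow> real" where
  "content = (\<lambda>(i, j). real j - real i)"

definition diagrams :: "nat \<Rightarrow> (nat \<times> nat) set set" where
  "diagrams n = {S. diagram S \<and> card S = n}"

lemma diagramI:
  assumes "finite S" "\<And>i j. (i, j) \<in> S \<Longrightarrow> 1 \<le> i \<and> 1 \<le> j"
    "\<And>i j i' j'. (i, j) \<in> S \<Longrightarrow> 1 \<le> i' \<Longrightarrow> i' \<le> i \<Longrightarrow> 1 \<le> j' \<Longrightarrow> j' \<le> j \<Longrightarrow> (i', j') \<in> S"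
  shows "diagram S"
  using assms unfolding diagram_def by blast

lemma diagram_finite: "diagram S \<Longrightarrow> finite S"
  by (simp add: diagram_def)

lemma diagram_pos: "diagram S \<Longrightarrow> (i, j) \<in> S \<Longrightarrow> 1 \<le> i \<and> 1 \<le> j"
  unfolding diagram_def by blast

lemma diagram_down:
  "diagram S \<Longrightarrow> (i, j) \<in> S \<Longrightarrow> 1 \<le> i' \<Longrightarrow> i' \<le> i \<Longrightarrow> 1 \<le> j' \<Longrightarrow> j' \<le> j \<Longrightarrow> (i', j') \<in> S"
  unfolding diagram_def by blast

lemma diagram_empty: "diagram {}"
  by (simp add: diagram_def)

lemma diagram_Int: "diagram S \<Longrightarrow> diagram T \<Longrightarrow> diagram (S \<inter> T)"
  unfolding diagram_def by blast

lemma diagram_Un: "diagram S \<Longrightarrow> diagram T \<Longrightarrow> diagram (S \<union> T)"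
  unfolding diagram_def by blast

text \<open>A box weakly north-west of \<open>(i, j)\<close> and different from it lies weakly
  north-west of the upper or of the left neighbour, so closure needs checking only there. In the
  first row or column the corresponding neighbour is missing and nothing is required.\<close>

lemma addable_iff:
  assumes S: "diagram S"
  shows "(i, j) \<in> addable S \<longleftrightarrow> (i, j) \<notin> S \<and> 1 \<le> i \<and> 1 \<le> j \<and>
           (i = 1 \<or> (i - 1, j) \<in> S) \<and> (j = 1 \<or> (i, j - 1) \<in> S)" (is "?L \<longleftrightarrow> ?R")
proof
  assume L: ?L
  then have n: "(i, j) \<notin> S" and d: "diagram (insert (i, j) S)" by (auto simp: addable_def)
  have p: "1 \<le> i" "1 \<le> j" using diagram_pos[OF d] by auto
  have "(i - 1, j) \<in> insert (i, j) S" if "i \<noteq> 1"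
    using diagram_down[OF d, of i j "i - 1" j] p that by (cases i) auto
  moreover have "(i, j - 1) \<in> insert (i, j) S" if "j \<noteq> 1"
    using diagram_down[OF d, of i j i "j - 1"] p that by (cases j) auto
  moreover have "i - 1 \<noteq> i" "j - 1 \<noteq> j" using p by auto
  ultimately show ?R using n p by blast
next
  assume R: ?R
  have "(i', j') \<in> insert (i, j) S" if "1 \<le> i'" "i' \<le> i" "1 \<le> j'" "j' \<le> j" for i' j'
  proof -
    consider "i' = i" "j' = j" | "i' \<le> i - 1" | "j' \<le> j - 1" using \<open>i' \<le> i\<close> \<open>j' \<le> j\<close> by linarith
    then show ?thesis
    proof cases
      case 2
      then have "(i - 1, j) \<in> S" using R that by auto
      then show ?thesis using diagram_down[OF S] 2 that by blast
    next
      case 3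
      then have "(i, j - 1) \<in> S" using R that by auto
      then show ?thesis using diagram_down[OF S] 3 that by blast
    qed simp
  qed
  note box = this
  have "diagram (insert (i, j) S)"
  proof (rule diagramI)
    show "finite (insert (i, j) S)" using S by (simp add: diagram_finite)
    show "1 \<le> k \<and> 1 \<le> l" if "(k, l) \<in> insert (i, j) S" for k l
      using that R diagram_pos[OF S] by blast
    show "(k', l') \<in> insert (i, j) S"
      if "(k, l) \<in> insert (i, j) S" "1 \<le> k'" "k' \<le> k" "1 \<le> l'" "l' \<le> l" for k l k' l'
      using that box diagram_down[OF S, of k l k' l'] by blast
  qed
  then show ?L using R by (simp add: addable_def)
qed

text \<open>Any other box of \<open>S\<close> weakly south-east of \<open>(i, j)\<close> would force
  the lower or the right neighbour into \<open>S\<close>.\<close>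

lemma removable_iff:
  assumes S: "diagram S"
  shows "(i, j) \<in> removable S \<longleftrightarrow> (i, j) \<in> S \<and> (Suc i, j) \<notin> S \<and> (i, Suc j) \<notin> S" (is "?L \<longleftrightarrow> ?R")
proof
  assume L: ?L
  then have m: "(i, j) \<in> S" and d: "diagram (S - {(i, j)})" by (auto simp: removable_def)
  have p: "1 \<le> i" "1 \<le> j" using diagram_pos[OF S m] by auto
  show ?R using diagram_down[OF d, of "Suc i" j i j] diagram_down[OF d, of i "Suc j" i j] m p by auto
next
  assume R: ?R
  have "(i', j') = (i, j)" if "(i', j') \<in> S" "i \<le> i'" "j \<le> j'" for i' j'
  proof (rule ccontr)
    assume "(i', j') \<noteq> (i, j)"
    then have "Suc i \<le> i' \<or> Suc j \<le> j'" using that by auto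
    then show False
      using R that diagram_down[OF S that(1)] diagram_pos[OF S, of i j] by auto
  qed
  note outer = this
  have "diagram (S - {(i, j)})"
  proof (rule diagramI)
    show "finite (S - {(i, j)})" using S by (simp add: diagram_finite)
    show "1 \<le> k \<and> 1 \<le> l" if "(k, l) \<in> S - {(i, j)}" for k l
      using that diagram_pos[OF S] by blast
    show "(k', l') \<in> S - {(i, j)}"
      if "(k, l) \<in> S - {(i, j)}" "1 \<le> k'" "k' \<le> k" "1 \<le> l'" "l' \<le> l" for k l k' l'
      using that outer[of k l] diagram_down[OF S, of k l k' l'] by blast
  qed
  then show ?L using R by (simp add: removable_def)
qed

lemma finite_removable: "diagram S \<Longrightarrow> finite (removable S)"
  by (simp add: removable_def diagram_finite)

text \<open>An addable box other than \<open>(1, 1)\<close> is the lower or right neighbour of a box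
  of \<open>S\<close>.\<close>

lemma finite_addable:
  assumes "diagram S" shows "finite (addable S)"
proof -
  have sub: "addable S \<subseteq> insert (1, 1) ((\<lambda>(i, j). (Suc i, j)) ` S \<union> (\<lambda>(i, j). (i, Suc j)) ` S)"
  proof
    fix v assume "v \<in> addable S"
    moreover obtain i j where v: "v = (i, j)" by (cases v)
    ultimately have a: "1 \<le> i" "1 \<le> j" "i = 1 \<or> (i - 1, j) \<in> S" "j = 1 \<or> (i, j - 1) \<in> S"
      by (auto simp: addable_iff[OF assms])
    then consider "v = (1, 1)" | "(i - 1, j) \<in> S" | "(i, j - 1) \<in> S" using v by auto
    then show "v \<in> insert (1, 1) ((\<lambda>(i, j). (Suc i, j)) ` S \<union> (\<lambda>(i, j). (i, Suc j)) ` S)"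
    proof cases
      case 2
      then have "v \<in> (\<lambda>(i, j). (Suc i, j)) ` S" using a v by (intro rev_image_eqI) auto
      then show ?thesis by blast
    next
      case 3
      then have "v \<in> (\<lambda>(i, j). (i, Suc j)) ` S" using a v by (intro rev_image_eqI) auto
      then show ?thesis by blast
    qed simp
  qed
  show ?thesis using diagram_finite[OF assms] by (intro finite_subset[OF sub]) simp
qed

text \<open>A box with maximal \<open>i + j\<close> has neither a lower nor a right
  neighbour.\<close>

lemma removable_nonempty:
  assumes "diagram S" "S \<noteq> {}"
  shows "removable S \<noteq> {}"
proof -
  have fin: "finite ((\<lambda>(i, j). i + j) ` S)" "(\<lambda>(i, j). i + j) ` S \<noteq> {}"
    using assms by (auto simp: diagram_def)
  obtain i j where ij: "(i, j) \<in> S" "i + j = Max ((\<lambda>(i, j). i + j) ` S)"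
    using Max_in[OF fin] by auto
  have "i' + j' \<le> i + j" if "(i', j') \<in> S" for i' j'
    unfolding ij(2) using that fin(1) by (intro Max_ge rev_image_eqI[OF that]) simp_all
  from this[of "Suc i" j] this[of i "Suc j"] have "(i, j) \<in> removable S"
    using ij(1) by (auto simp: removable_iff[OF assms(1)])
  then show ?thesis by blast
qed

lemma diagram_induct [consumes 1, case_names empty insert]:
  assumes "diagram S" "P {}"
    "\<And>v S. diagram S \<Longrightarrow> v \<in> addable S \<Longrightarrow> P S \<Longrightarrow> P (insert v S)"
  shows "P S"
  using assms(1)
proof (induction "card S" arbitrary: S)
  case 0
  then show ?case using assms(2) by (simp add: diagram_def)
next
  case (Suc n)
  then obtain v where v: "v \<in> removable S" using removable_nonempty[of S] by fastforce
  then have d: "diagram (S - {v})" "v \<in> S" by (auto simp: removable_def)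
  have "P (S - {v})" using Suc d by (intro Suc.hyps) (auto simp: card_Diff_singleton)
  moreover have "v \<in> addable (S - {v})" using Suc.prems d by (simp add: addable_def insert_absorb)
  ultimately have "P (insert v (S - {v}))" using assms(3) d by blast
  then show ?case using d by (simp add: insert_absorb)
qed

text \<open>Only the boundary near the new box \<open>(i, j)\<close> changes: the box below it becomes addable unless
  its left neighbour \<open>(i, j - 1)\<close>, which has the same content as the box below, was removable and
  now ceases to be so; similarly for the box to the right.\<close>

lemma sum_addable_removable:
  assumes "diagram S"
  shows "(\<Sum>v\<in>addable S. g (content v)) - (\<Sum>v\<in>removable S. g (content v)) =
    g 0 + (\<Sum>v\<in>S. g (content v + 1) + g (content v - 1) - 2 * g (content v) :: real)"
  using assms
proof (induction rule: diagram_induct)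
  case empty
  have "addable {} = {(1, 1)}"
    using addable_iff[OF diagram_empty] by auto
  then show ?case by (simp add: removable_def content_def)
next
  case (insert v S)
  obtain i j where v: "v = (i, j)" by (cases v)
  let ?S = "insert v S"
  have dS: "diagram S" and dS': "diagram ?S" using insert by (auto simp: addable_def)
  have a: "(i, j) \<notin> S" "1 \<le> i" "1 \<le> j" "i = 1 \<or> (i - 1, j) \<in> S" "j = 1 \<or> (i, j - 1) \<in> S"
    using insert(2) by (auto simp: v addable_iff[OF dS])
  have below: "(i', j') \<notin> S" if "i \<le> i'" "j \<le> j'" for i' j'
    using diagram_down[OF dS, of i' j' i j] a that by auto
  \<comment> \<open>\<open>E1\<close> and \<open>E2\<close> decide whether the box below,
    respectively to the right of, \<open>(i, j)\<close> becomes addable. \<open>A\<close> and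
    \<open>R\<close> collect the addable and removable boxes that the new box does not
    affect.\<close>
  define E1 where "E1 \<longleftrightarrow> j = 1 \<or> (Suc i, j - 1) \<in> S"
  define E2 where "E2 \<longleftrightarrow> i = 1 \<or> (i - 1, Suc j) \<in> S"
  define A where "A = addable S - {v}"
  define R where "R = removable S - {(i, j - 1), (i - 1, j)}"
  have fin: "finite A" "finite R"
    by (simp_all add: A_def R_def finite_addable finite_removable dS)
  have add: "addable ?S = A \<union> (if E1 then {(Suc i, j)} else {}) \<union> (if E2 then {(i, Suc j)} else {})"
    (is "_ = ?A'")
  proof (rule set_eqI, clarify)
    fix k l
    consider "(k, l) = (Suc i, j)" | "(k, l) = (i, Suc j)" | "(k, l) \<noteq> (Suc i, j)" "(k, l) \<noteq> (i, Suc j)"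
      by blast
    then show "(k, l) \<in> addable ?S \<longleftrightarrow> (k, l) \<in> ?A'"
    proof cases
      case 1
      then show ?thesis using a(1-3) below[of "Suc i" j]
        by (simp add: A_def v addable_iff[OF dS] addable_iff[OF dS'[unfolded v]] E1_def)
    next
      case 2
      then show ?thesis using a(1-3) below[of i "Suc j"]
        by (simp add: A_def v addable_iff[OF dS] addable_iff[OF dS'[unfolded v]] E2_def)
    next
      case 3
      then have "(k, l) \<in> ?A' \<longleftrightarrow> (k, l) \<in> addable S \<and> (k, l) \<noteq> (i, j)"
        unfolding A_def v by (cases E1; cases E2; auto)
      moreover have "1 \<le> k \<Longrightarrow> (k - 1, l) \<noteq> (i, j)" "1 \<le> l \<Longrightarrow> (k, l - 1) \<noteq> (i, j)"
        using 3 by auto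
      ultimately show ?thesis
        unfolding v addable_iff[OF dS] addable_iff[OF dS'[unfolded v]] by blast
    qed
  qed
  have addS: "addable S = insert v A" using insert(2) by (auto simp: A_def)
  have notinA: "(Suc i, j) \<notin> A" "(i, Suc j) \<notin> A" "v \<notin> A"
    using a by (auto simp: A_def addable_iff[OF dS])
  have rem: "removable ?S = insert v R"
  proof (rule set_eqI, clarify)
    fix k l
    have 1: "(Suc k, l) \<noteq> (i, j) \<and> (k, Suc l) \<noteq> (i, j) \<longleftrightarrow> (k, l) \<notin> {(i, j - 1), (i - 1, j)}"
      if "(k, l) \<noteq> (i, j)"
      using a(2,3) that by auto
    have 2: "(Suc i, j) \<notin> ?S" "(i, Suc j) \<notin> ?S" using below v by auto
    show "(k, l) \<in> removable ?S \<longleftrightarrow> (k, l) \<in> insert v R"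
    proof (cases "(k, l) = (i, j)")
      case True
      then show ?thesis using 2 by (simp add: v removable_iff[OF dS'[unfolded v]])
    next
      case False
      then show ?thesis using 1
        unfolding R_def v Diff_iff insert_iff removable_iff[OF dS] removable_iff[OF dS'[unfolded v]]
        by blast
    qed
  qed
  have remS: "removable S = R \<union> (if E1 then {} else {(i, j - 1)}) \<union> (if E2 then {} else {(i - 1, j)})"
  proof -
    \<comment> \<open>For \<open>j = 1\<close> truncated subtraction yields \<open>(i, 0)\<close>,
      which is outside \<open>S\<close>; this agrees with \<open>E1\<close> being true. The same
      happens for \<open>i = 1\<close> and \<open>E2\<close>.\<close>
    have "(i, j - 1) \<in> removable S \<longleftrightarrow> \<not> E1"
      using a(1,3,5) diagram_pos[OF dS, of i 0] by (cases "j = 1") (auto simp: removable_iff[OF dS] E1_def)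
    moreover have "(i - 1, j) \<in> removable S \<longleftrightarrow> \<not> E2"
      using a(1,2,4) diagram_pos[OF dS, of 0 j] by (cases "i = 1") (auto simp: removable_iff[OF dS] E2_def)
    ultimately show ?thesis unfolding R_def by (cases E1; cases E2; simp; blast)
  qed
  have notinR: "(i, j - 1) \<notin> R" "(i - 1, j) \<notin> R" "v \<notin> R"
    using a by (auto simp: R_def v removable_iff[OF dS])
  have ne: "(i, j - 1) \<noteq> (i - 1, j)" using a by auto
  define G where "G = (\<lambda>v. g (content v))"
  have sadd: "sum G (addable ?S) = sum G A + (if E1 then G (Suc i, j) else 0) + (if E2 then G (i, Suc j) else 0)"
    unfolding add using fin notinA by (auto simp: sum.union_disjoint)
  have sremS: "sum G (removable S) = sum G R + (if E1 then 0 else G (i, j - 1)) + (if E2 then 0 else G (i - 1, j))"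
    unfolding remS using fin notinR ne by (auto simp: sum.union_disjoint)
  have c: "G (Suc i, j) = g (content v - 1)" "G (i, Suc j) = g (content v + 1)"
    "G (i, j - 1) = g (content v - 1)" "G (i - 1, j) = g (content v + 1)"
    using a by (auto simp: G_def content_def v of_nat_diff algebra_simps)
  have srem: "sum G (removable ?S) = sum G R + G v" unfolding rem using fin notinR by simp
  have saddS: "sum G (addable S) = sum G A + G v" unfolding addS using fin notinA by simp
  have "v \<notin> S" using a v by simp
  then have "(\<Sum>v\<in>?S. g (content v + 1) + g (content v - 1) - 2 * g (content v)) =
      g (content v + 1) + g (content v - 1) - 2 * G v +
      (\<Sum>v\<in>S. g (content v + 1) + g (content v - 1) - 2 * g (content v))"
    using diagram_finite[OF dS] by (simp add: G_def)
  moreover have "sum G (addable S) - sum G (removable S) =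
      g 0 + (\<Sum>v\<in>S. g (content v + 1) + g (content v - 1) - 2 * g (content v))"
    using insert(3) by (simp add: G_def)
  \<comment> \<open>With \<open>c\<close> the content of \<open>v\<close>, each of the four cases
    changes the difference by \<open>g (c - 1) + g (c + 1) - 2 * g c\<close>: a neighbouring content
    is either gained among the addable boxes or lost among the removable ones, and \<open>v\<close>
    itself changes sides.\<close>
  ultimately have "sum G (addable ?S) - sum G (removable ?S) =
      g 0 + (\<Sum>v\<in>?S. g (content v + 1) + g (content v - 1) - 2 * g (content v))"
    unfolding sadd srem saddS sremS c by (cases E1; cases E2; simp)
  then show ?case by (simp add: G_def)
qed

section \<open>Counting standard tableaux\<close>

text \<open>The conditions of \<open>standard_tableaux\<close> for a bare set of boxes, so that the
  recursion over corners avoids lists.\<close>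

definition tableaux :: "(nat \<times> nat) set \<Rightarrow> (nat \<times> nat \<Rightarrow> nat) set" where
  "tableaux S =
     {T. T \<in> extensional S \<and> bij_betw T S {1..card S} \<and>
         (\<forall>i j j'. (i, j) \<in> S \<and> (i, j') \<in> S \<and> j < j' \<longrightarrow> T (i, j) < T (i, j')) \<and>
         (\<forall>i i' j. (i, j) \<in> S \<and> (i', j) \<in> S \<and> i < i' \<longrightarrow> T (i, j) < T (i', j))}"

definition num_tableaux :: "(nat \<times> nat) set \<Rightarrow> real" where
  "num_tableaux S = real (card (tableaux S))"

lemma finite_tableaux: "finite S \<Longrightarrow> finite (tableaux S)"
proof (rule finite_subset)
  show "tableaux S \<subseteq> S \<rightarrow>\<^sub>E {1..card S}"
    by (auto simp: tableaux_def PiE_def bij_betw_def)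
  show "finite S \<Longrightarrow> finite (S \<rightarrow>\<^sub>E {1..card S})" by (intro finite_PiE) auto
qed

lemma num_tableaux_empty: "num_tableaux {} = 1"
proof -
  have "tableaux {} = {\<lambda>_. undefined}" by (auto simp: tableaux_def bij_betw_def)
  then show ?thesis by (simp add: num_tableaux_def)
qed

text \<open>No other box of \<open>S\<close> lies weakly south-east of a corner \<open>v\<close>, so
  the new largest entry in \<open>v\<close> never has to be the smaller one in a comparison.\<close>

lemma fun_upd_mem_tableaux:
  assumes S: "diagram S" and v: "v \<in> removable S" and T: "T \<in> tableaux (S - {v})"
  shows "T(v := card S) \<in> tableaux S"
proof -
  have fin: "finite S" and vS: "v \<in> S" using S v by (simp_all add: diagram_finite removable_def)
  then have c: "card S = Suc (card (S - {v}))" by (metis card_Suc_Diff1)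
  have T1: "T \<in> extensional (S - {v})" "bij_betw T (S - {v}) {1..card (S - {v})}"
    and T2: "\<And>i j j'. (i, j) \<in> S - {v} \<Longrightarrow> (i, j') \<in> S - {v} \<Longrightarrow> j < j' \<Longrightarrow> T (i, j) < T (i, j')"
    and T3: "\<And>i i' j. (i, j) \<in> S - {v} \<Longrightarrow> (i', j) \<in> S - {v} \<Longrightarrow> i < i' \<Longrightarrow> T (i, j) < T (i', j)"
    using T by (auto simp: tableaux_def)
  have lt: "T x < card S" if "x \<in> S - {v}" for x
    using bij_betwE[OF T1(2)] that unfolding c by (simp add: less_Suc_eq_le)
  have nogt: "(i', j') = v" if "v = (i, j)" "(i', j') \<in> S" "i \<le> i'" "j \<le> j'" for i j i' j'
  proof (rule ccontr)
    assume "(i', j') \<noteq> v"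
    then show False
      using diagram_down[of "S - {v}" i' j' i j] v that diagram_pos[OF S, of i j] vS
      by (auto simp: removable_def)
  qed
  have "bij_betw (T(v := card S)) (S - {v}) {1..card (S - {v})}"
    using T1(2) by (rule bij_betw_cong[THEN iffD1, rotated]) auto
  then have "bij_betw (T(v := card S)) ((S - {v}) \<union> {v}) ({1..card (S - {v})} \<union> {card S})"
    by (rule bij_betw_combine) (auto simp: c)
  moreover have "(S - {v}) \<union> {v} = S" using vS by auto
  moreover have "{1..card (S - {v})} \<union> {card S} = {1..card S}" using c by auto
  ultimately have "bij_betw (T(v := card S)) S {1..card S}" by simp
  moreover have "T(v := card S) \<in> extensional S"
    using T1(1) vS by (auto simp: extensional_def)
  moreover have "(T(v := card S)) (i, j) < (T(v := card S)) (i, j')"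
    if "(i, j) \<in> S" "(i, j') \<in> S" "j < j'" for i j j'
  proof -
    have "(i, j) \<noteq> v" using nogt[of i j i j'] that by auto
    then show ?thesis using T2[of i j j'] lt[of "(i, j)"] that by auto
  qed
  moreover have "(T(v := card S)) (i, j) < (T(v := card S)) (i', j)"
    if "(i, j) \<in> S" "(i', j) \<in> S" "i < i'" for i i' j
  proof -
    have "(i, j) \<noteq> v" using nogt[of i j i' j] that by auto
    then show ?thesis using T3[of i j i'] lt[of "(i, j)"] that by auto
  qed
  ultimately show ?thesis unfolding tableaux_def by blast
qed

text \<open>The largest entry sits in a corner, since a right or lower neighbour would carry a still
  larger entry.\<close>

lemma tableaux_remove_largest:
  assumes S: "diagram S" and ne: "S \<noteq> {}" and T: "T \<in> tableaux S"
  obtains v T' where "v \<in> removable S" "T' \<in> tableaux (S - {v})" "T = T'(v := card S)"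
proof -
  have fin: "finite S" using S by (rule diagram_finite)
  have T1: "T \<in> extensional S" "bij_betw T S {1..card S}"
    and T2: "\<And>i j j'. (i, j) \<in> S \<Longrightarrow> (i, j') \<in> S \<Longrightarrow> j < j' \<Longrightarrow> T (i, j) < T (i, j')"
    and T3: "\<And>i i' j. (i, j) \<in> S \<Longrightarrow> (i', j) \<in> S \<Longrightarrow> i < i' \<Longrightarrow> T (i, j) < T (i', j)"
    using T by (auto simp: tableaux_def)
  have "card S \<ge> 1" using fin ne by (simp add: Suc_le_eq card_gt_0_iff)
  then have "card S \<in> T ` S" using T1(2) by (auto simp: bij_betw_def)
  then obtain v where v: "v \<in> S" "T v = card S" by auto
  then have c: "card S = Suc (card (S - {v}))" using fin by (metis card_Suc_Diff1)
  have le: "T x \<le> card S" if "x \<in> S" for x using bij_betwE[OF T1(2)] that by auto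
  obtain i j where ij: "v = (i, j)" by (cases v)
  have rem: "v \<in> removable S"
    using T2[of i j "Suc j"] T3[of i j "Suc i"] le[of "(i, Suc j)"] le[of "(Suc i, j)"] v
    by (auto simp: ij removable_iff[OF S])
  define T' where "T' = restrict T (S - {v})"
  have "bij_betw T (S - {v}) ({1..card S} - {card S})"
    by (rule bij_betw_DiffI[OF T1(2)]) (use v \<open>card S \<ge> 1\<close> in \<open>simp_all add: bij_betw_def\<close>)
  moreover have "{1..card S} - {card S} = {1..card (S - {v})}" using c by auto
  ultimately have "bij_betw T' (S - {v}) {1..card (S - {v})}"
    unfolding T'_def by (metis bij_betw_restrict_eq)
  then have "T' \<in> tableaux (S - {v})"
    unfolding tableaux_def using T2 T3 by (auto simp: T'_def)
  moreover have "T = T'(v := card S)"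
    using T1(1) v by (auto simp: T'_def extensional_def restrict_def)
  ultimately show ?thesis using rem that by blast
qed

text \<open>Branching rule: the tableaux are classified by the corner holding the largest entry, and
  deleting that entry is a bijection on each class.\<close>

lemma num_tableaux_rec:
  assumes S: "diagram S" and ne: "S \<noteq> {}"
  shows "num_tableaux S = (\<Sum>v\<in>removable S. num_tableaux (S - {v}))"
proof -
  let ?up = "\<lambda>v T. T(v := card S)"
  have fin: "finite S" using S by (rule diagram_finite)
  have "tableaux S = (\<Union>v\<in>removable S. ?up v ` tableaux (S - {v}))"
  proof (intro equalityI subsetI)
    fix T assume "T \<in> tableaux S"
    then obtain v T' where "v \<in> removable S" "T' \<in> tableaux (S - {v})" "T = T'(v := card S)"
      using tableaux_remove_largest[OF S ne] by metis
    then show "T \<in> (\<Union>v\<in>removable S. ?up v ` tableaux (S - {v}))" by blast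
  qed (use fun_upd_mem_tableaux[OF S] in auto)
  moreover have "card (\<Union>v\<in>removable S. ?up v ` tableaux (S - {v})) =
      (\<Sum>v\<in>removable S. card (?up v ` tableaux (S - {v})))"
  proof (rule card_UN_disjoint)
    show "\<forall>v\<in>removable S. \<forall>w\<in>removable S. v \<noteq> w \<longrightarrow>
        ?up v ` tableaux (S - {v}) \<inter> ?up w ` tableaux (S - {w}) = {}"
    proof (intro ballI impI equals0I)
      fix v w T assume vw: "v \<in> removable S" "w \<in> removable S" "v \<noteq> w"
        and T: "T \<in> ?up v ` tableaux (S - {v}) \<inter> ?up w ` tableaux (S - {w})"
      then have "T \<in> tableaux S" using fun_upd_mem_tableaux[OF S] by blast
      then have "inj_on T S" by (auto simp: tableaux_def bij_betw_def)
      moreover obtain T1 T2 where "T = T1(v := card S)" "T = T2(w := card S)" using T by blast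
      then have "T v = card S" "T w = card S" by (simp, metis fun_upd_same)
      ultimately show False using vw by (auto simp: inj_on_def removable_def)
    qed
  qed (use fin finite_removable[OF S] finite_tableaux in auto)
  moreover have "card (?up v ` tableaux (S - {v})) = card (tableaux (S - {v}))" for v
  proof (rule card_image, rule inj_onI)
    fix T T' assume T: "T \<in> tableaux (S - {v})" "T' \<in> tableaux (S - {v})" and eq: "?up v T = ?up v T'"
    \<comment> \<open>Extensionality fixes the value at \<open>v\<close> before the update, so
      overwriting it loses no information.\<close>
    have "v \<notin> S - {v}" "T \<in> extensional (S - {v})" "T' \<in> extensional (S - {v})"
      using T by (simp_all add: tableaux_def)
    then have "T v = T' v" by (metis extensional_arb)
    moreover have "T x = T' x" if "x \<noteq> v" for x using fun_cong[OF eq, of x] that by simp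
    ultimately show "T = T'" by (metis ext)
  qed
  ultimately show ?thesis unfolding num_tableaux_def by simp
qed

section \<open>Adding a box to a diagram\<close>

text \<open>General in \<open>g\<close>, so that one recursion serves both the zeroth and the second
  content moment.\<close>

definition up_sum :: "(nat \<times> nat \<Rightarrow> real) \<Rightarrow> (nat \<times> nat) set \<Rightarrow> real" where
  "up_sum g M = (\<Sum>v\<in>addable M. g v * num_tableaux (insert v M))"

text \<open>The commutation relation of the up and down operators on Young's lattice, with the added box
  weighted by \<open>g\<close>: removing a box \<open>w \<noteq> v\<close> after adding \<open>v\<close> is the same as adding \<open>v\<close> after
  removing \<open>w\<close>, and only the terms with \<open>v = w\<close> do not cancel.\<close>

lemma up_sum_rec:
  assumes M: "diagram M"
  shows "up_sum g M = num_tableaux M * (sum g (addable M) - sum g (removable M)) +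
           (\<Sum>w\<in>removable M. up_sum g (M - {w}))"
proof -
  let ?F = num_tableaux
  have fA: "finite (addable M)" and fR: "finite (removable M)"
    using M finite_addable finite_removable by auto
  let ?L = "SIGMA v:addable M. removable (insert v M) - {v}"
  let ?R = "SIGMA w:removable M. addable (M - {w}) - {w}"
  have "up_sum g M = (\<Sum>v\<in>addable M. g v * ?F M +
      (\<Sum>w\<in>removable (insert v M) - {v}. g v * ?F (insert v M - {w})))"
    unfolding up_sum_def
  proof (rule sum.cong)
    fix v assume v: "v \<in> addable M"
    then have d: "diagram (insert v M)" and "v \<notin> M" by (auto simp: addable_def)
    \<comment> \<open>In the branching rule for \<open>insert v M\<close>, removing \<open>v\<close>
      itself returns \<open>M\<close>; this term is split off.\<close>
    then have r: "v \<in> removable (insert v M)" and eq: "insert v M - {v} = M"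
      using M by (auto simp: removable_def)
    show "g v * ?F (insert v M) = g v * ?F M + (\<Sum>w\<in>removable (insert v M) - {v}. g v * ?F (insert v M - {w}))"
      using num_tableaux_rec[OF d] sum.remove[OF finite_removable[OF d] r, of "\<lambda>w. ?F (insert v M - {w})"] eq
      by (simp add: distrib_left sum_distrib_left)
  qed simp
  also have "\<dots> = sum g (addable M) * ?F M + (\<Sum>(v, w)\<in>?L. g v * ?F (insert v M - {w}))"
    using fA finite_removable
    by (simp add: sum.distrib sum_distrib_right sum.Sigma addable_def)
  also have "(\<Sum>(v, w)\<in>?L. g v * ?F (insert v M - {w})) =
      (\<Sum>(w, v)\<in>?R. g v * ?F (insert v (M - {w})))"
  proof (rule sum.reindex_bij_witness[of _ prod.swap prod.swap])
    fix x assume "x \<in> ?L"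
    then obtain v w where x: "x = (v, w)" and v: "v \<in> addable M"
      and w: "w \<in> removable (insert v M)" "w \<noteq> v" by auto
    have w': "w \<in> M" "v \<notin> M" using v w by (auto simp: removable_def addable_def)
    \<comment> \<open>Removability of \<open>w\<close> passes to \<open>M\<close> because diagrams
      are closed under intersection; in the other direction, closure under union shows that
      \<open>v\<close> can be added to \<open>M\<close>.\<close>
    have "M - {w} = M \<inter> (insert v M - {w})" by blast
    then have "w \<in> removable M"
      using diagram_Int[OF M, of "insert v M - {w}"] w w' by (simp add: removable_def)
    moreover have eq: "insert v (M - {w}) = insert v M - {w}" using w by blast
    then have "v \<in> addable (M - {w})" using w w' by (simp add: addable_def removable_def)
    ultimately show "prod.swap x \<in> ?R" using w x by auto
    show "(case prod.swap x of (w, v) \<Rightarrow> g v * ?F (insert v (M - {w}))) =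
        (case x of (v, w) \<Rightarrow> g v * ?F (insert v M - {w}))"
      using eq x by simp
  next
    fix x assume "x \<in> ?R"
    then obtain v w where x: "x = (w, v)" and w: "w \<in> removable M"
      and v: "v \<in> addable (M - {w})" "v \<noteq> w" by auto
    have w': "w \<in> M" "v \<notin> M" using v w by (auto simp: removable_def addable_def)
    have "insert v M = M \<union> insert v (M - {w})" by blast
    then have "v \<in> addable M"
      using diagram_Un[OF M, of "insert v (M - {w})"] v w' by (simp add: addable_def)
    moreover have "insert v (M - {w}) = insert v M - {w}" using v by blast
    then have "w \<in> removable (insert v M)" using v w' by (simp add: addable_def removable_def)
    ultimately show "prod.swap x \<in> ?L" using v x by auto
  qed auto
  also have "\<dots> = (\<Sum>w\<in>removable M. \<Sum>v\<in>addable (M - {w}) - {w}. g v * ?F (insert v (M - {w})))"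
    using fR finite_addable by (simp add: sum.Sigma removable_def)
  \<comment> \<open>The box \<open>w\<close> is always addable to \<open>M - {w}\<close>, and this
    excluded term of \<open>up_sum\<close> contributes \<open>g w\<close> times the count for
    \<open>M\<close>.\<close>
  also have "\<dots> = (\<Sum>w\<in>removable M. up_sum g (M - {w}) - g w * ?F M)"
  proof (rule sum.cong)
    fix w assume "w \<in> removable M"
    then have w: "w \<in> M" "diagram (M - {w})" by (auto simp: removable_def)
    then have "w \<in> addable (M - {w})" "insert w (M - {w}) = M"
      using M by (auto simp: addable_def insert_absorb)
    then show "(\<Sum>v\<in>addable (M - {w}) - {w}. g v * ?F (insert v (M - {w}))) =
        up_sum g (M - {w}) - g w * ?F M"
      unfolding up_sum_def
      using sum.remove[OF finite_addable[OF w(2)], of w "\<lambda>v. g v * ?F (insert v (M - {w}))"]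
      by simp
  qed simp
  finally show ?thesis
    by (simp add: sum_subtractf sum_distrib_left algebra_simps)
qed

text \<open>Since the excess depends only on the size, by induction all \<open>M - {w}\<close> carry
  the same factor, and the branching rule sums their tableau counts to that of
  \<open>M\<close>.\<close>

lemma up_sum_eq:
  assumes add_rem: "\<And>M. diagram M \<Longrightarrow> sum g (addable M) - sum g (removable M) = k (card M)"
    and "diagram M"
  shows "up_sum g M = (\<Sum>m\<le>card M. k m) * num_tableaux M"
  using assms(2)
proof (induction "card M" arbitrary: M)
  case 0
  then have "M = {}" by (simp add: diagram_def)
  then show ?case
    using up_sum_rec[OF 0(2), of g] add_rem[OF 0(2)] by (simp add: removable_def)
next
  case (Suc n)
  have "up_sum g (M - {w}) = (\<Sum>m\<le>n. k m) * num_tableaux (M - {w})" if "w \<in> removable M" for w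
  proof -
    have "n = card (M - {w})" "diagram (M - {w})"
      using Suc.hyps(2) that by (simp_all add: removable_def)
    then show ?thesis using Suc.hyps(1) by metis
  qed
  then have "(\<Sum>w\<in>removable M. up_sum g (M - {w})) = (\<Sum>m\<le>n. k m) * num_tableaux M"
    using num_tableaux_rec[OF Suc.prems] Suc.hyps(2) by (cases "M = {}") (simp_all add: sum_distrib_left)
  then show ?case
    using up_sum_rec[OF Suc.prems, of g] add_rem[OF Suc.prems] Suc.hyps(2)[symmetric]
    by (simp add: algebra_simps)
qed

text \<open>The second difference of a constant vanishes, so the excess is 1 for each of the
  \<open>card M + 1\<close> sizes up to \<open>card M\<close>.\<close>

lemma up_sum_one:
  assumes "diagram M"
  shows "up_sum (\<lambda>_. 1) M = (real (card M) + 1) * num_tableaux M"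
  using up_sum_eq[of "\<lambda>_. 1" "\<lambda>_. 1" M] sum_addable_removable[where g = "\<lambda>_. 1"] assms
  by simp

text \<open>The second difference of the square is 2 and the square vanishes at 0, so the excess at
  size \<open>m\<close> is \<open>2 * m\<close>.\<close>

lemma up_sum_content_square:
  assumes "diagram M"
  shows "up_sum (\<lambda>v. content v ^ 2) M = real (card M) * (real (card M) + 1) * num_tableaux M"
proof -
  have "(x + 1)^2 + (x - 1)^2 - 2 * x^2 = 2" for x :: real by (simp add: power2_eq_square algebra_simps)
  then have "up_sum (\<lambda>v. content v ^ 2) M = (\<Sum>m\<le>card M. 2 * real m) * num_tableaux M"
    using sum_addable_removable[where g = "\<lambda>x. x ^ 2"] assms
    by (intro up_sum_eq) simp_all
  also have "(\<Sum>m\<le>n. 2 * real m) = real n * (real n + 1)" for n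
    by (induction n) (auto simp: algebra_simps)
  finally show ?thesis .
qed

section \<open>Averages over all diagrams of a given size\<close>

text \<open>A box \<open>(i, j)\<close> forces \<open>i\<close> boxes in its column and
  \<open>j\<close> boxes in its row, so both coordinates are at most \<open>n\<close>.\<close>

lemma finite_diagrams: "finite (diagrams n)"
proof (rule finite_subset)
  show "diagrams n \<subseteq> Pow ({1..n} \<times> {1..n})"
  proof clarify
    fix S i j assume S: "S \<in> diagrams n" and ij: "(i, j) \<in> S"
    have d: "diagram S" and c: "card S = n" using S by (auto simp: diagrams_def)
    have p: "1 \<le> i" "1 \<le> j" using diagram_pos[OF d ij] by auto
    have "(\<lambda>k. (k, j)) ` {1..i} \<subseteq> S" "(\<lambda>k. (i, k)) ` {1..j} \<subseteq> S"
      using diagram_down[OF d ij] p by auto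
    then have "card ((\<lambda>k. (k, j)) ` {1..i}) \<le> n" "card ((\<lambda>k. (i, k)) ` {1..j}) \<le> n"
      using card_mono[OF diagram_finite[OF d]] c by metis+
    then show "i \<in> {1..n} \<and> j \<in> {1..n}"
      using p by (auto simp: card_image inj_on_def)
  qed
qed simp

text \<open>One factor \<open>num_tableaux S\<close> is expanded by the branching rule; pairs of a
  diagram and a removable box then correspond to pairs of a smaller diagram and an addable
  box.\<close>

lemma sum_diagrams_Suc:
  "(\<Sum>S\<in>diagrams (Suc n). num_tableaux S ^ 2 * w S) =
   (\<Sum>M\<in>diagrams n. num_tableaux M * (\<Sum>v\<in>addable M. num_tableaux (insert v M) * w (insert v M)))"
  (is "?A = ?B")
proof -
  let ?F = num_tableaux
  have "?A = (\<Sum>S\<in>diagrams (Suc n). \<Sum>v\<in>removable S. ?F (S - {v}) * (?F S * w S))"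
  proof (rule sum.cong)
    fix S assume "S \<in> diagrams (Suc n)"
    then have "diagram S" "S \<noteq> {}" by (auto simp: diagrams_def)
    then have "(\<Sum>v\<in>removable S. ?F (S - {v}) * (?F S * w S)) = ?F S * (?F S * w S)"
      using num_tableaux_rec by (simp add: sum_distrib_right)
    then show "?F S ^ 2 * w S = (\<Sum>v\<in>removable S. ?F (S - {v}) * (?F S * w S))"
      by (simp add: power2_eq_square)
  qed simp
  also have "\<dots> = (\<Sum>(S, v)\<in>(SIGMA S:diagrams (Suc n). removable S). ?F (S - {v}) * (?F S * w S))"
    using finite_diagrams finite_removable by (intro sum.Sigma) (auto simp: diagrams_def)
  also have "\<dots> = (\<Sum>(M, v)\<in>(SIGMA M:diagrams n. addable M). ?F M * (?F (insert v M) * w (insert v M)))"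
    by (rule sum.reindex_bij_witness[of _ "\<lambda>(M, v). (insert v M, v)" "\<lambda>(S, v). (S - {v}, v)"])
      (auto simp: diagrams_def removable_def addable_def insert_absorb diagram_finite)
  also have "\<dots> = (\<Sum>M\<in>diagrams n. \<Sum>v\<in>addable M. ?F M * (?F (insert v M) * w (insert v M)))"
    using finite_diagrams finite_addable by (intro sum.Sigma[symmetric]) (auto simp: diagrams_def)
  also have "\<dots> = ?B" by (simp add: sum_distrib_left)
  finally show ?thesis .
qed

lemma diagrams_0: "diagrams 0 = {{}}"
  by (auto simp: diagrams_def diagram_def)

lemma sum_num_tableaux_square: "(\<Sum>S\<in>diagrams n. num_tableaux S ^ 2) = fact n"
proof (induction n)
  case 0
  then show ?case by (simp add: diagrams_0 num_tableaux_empty)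
next
  case (Suc n)
  have "(\<Sum>S\<in>diagrams (Suc n). num_tableaux S ^ 2) = (\<Sum>M\<in>diagrams n. num_tableaux M * up_sum (\<lambda>_. 1) M)"
    using sum_diagrams_Suc[where w = "\<lambda>_. 1"] by (simp add: up_sum_def)
  also have "\<dots> = (\<Sum>M\<in>diagrams n. (real n + 1) * num_tableaux M ^ 2)"
    by (rule sum.cong) (auto simp: diagrams_def up_sum_one power2_eq_square)
  also have "\<dots> = fact (Suc n)"
    using Suc by (simp add: sum_distrib_left[symmetric] add.commute)
  finally show ?case .
qed

text \<open>Adding \<open>v\<close> increases the inner sum by the squared content of
  \<open>v\<close>, so the induction step splits into the zeroth moment times the old sum and the
  second moment.\<close>

lemma sum_content_square:
  "(\<Sum>S\<in>diagrams n. num_tableaux S ^ 2 * (\<Sum>v\<in>S. content v ^ 2)) = real n * (real n - 1) / 2 * fact n"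
proof (induction n)
  case 0
  then show ?case by (simp add: diagrams_0)
next
  case (Suc n)
  let ?F = num_tableaux and ?W = "\<lambda>S. \<Sum>v\<in>S. content v ^ 2"
  have "(\<Sum>v\<in>addable M. ?F (insert v M) * ?W (insert v M)) =
      (real n + 1) * ?F M * ?W M + real n * (real n + 1) * ?F M" if "M \<in> diagrams n" for M
  proof -
    have M: "diagram M" "card M = n" using that by (auto simp: diagrams_def)
    have "(\<Sum>v\<in>addable M. ?F (insert v M) * ?W (insert v M)) =
        (\<Sum>v\<in>addable M. 1 * ?F (insert v M) * ?W M + content v ^ 2 * ?F (insert v M))"
      by (rule sum.cong) (auto simp: addable_def diagram_finite[OF M(1)] algebra_simps)
    also have "\<dots> = up_sum (\<lambda>_. 1) M * ?W M + up_sum (\<lambda>v. content v ^ 2) M"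
      by (simp add: sum.distrib up_sum_def sum_distrib_right)
    finally show ?thesis using up_sum_one up_sum_content_square M by simp
  qed
  then have "(\<Sum>S\<in>diagrams (Suc n). ?F S ^ 2 * ?W S) =
      (\<Sum>M\<in>diagrams n. (real n + 1) * (?F M ^ 2 * ?W M) + real n * (real n + 1) * ?F M ^ 2)"
    unfolding sum_diagrams_Suc
    by (intro sum.cong) (simp_all add: algebra_simps power2_eq_square del: sum.insert)
  also have "\<dots> = (real n + 1) * (real n * (real n - 1) / 2 * fact n) + real n * (real n + 1) * fact n"
    by (simp only: sum.distrib sum_distrib_left[symmetric] Suc sum_num_tableaux_square)
  also have "\<dots> = real (Suc n) * (real (Suc n) - 1) / 2 * fact (Suc n)"
    by (simp add: field_simps)
  finally show ?case .
qed

section \<open>Partitions and their hook lengths\<close>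

lemma finite_boxes: "finite (boxes lam)"
proof (rule finite_subset)
  show "boxes lam \<subseteq> (SIGMA i:{1..length lam}. {1..part lam i})" by (auto simp: boxes_def)
qed auto

lemma boxes_Nil: "boxes [] = {}"
  by (auto simp: boxes_def)

lemma mem_boxes_Cons:
  "(i, j) \<in> boxes (a # lam) \<longleftrightarrow> i = 1 \<and> 1 \<le> j \<and> j \<le> a \<or> 2 \<le> i \<and> (i - 1, j) \<in> boxes lam"
  by (cases i; cases "i - 1") (auto simp: boxes_def part_def)

text \<open>Serves inductions over the list of parts, which peel off the first row and shift the
  others.\<close>

lemma sum_boxes_Cons:
  "(\<Sum>(i, j)\<in>boxes (a # lam). f i j :: real) = (\<Sum>j=1..a. f 1 j) + (\<Sum>(i, j)\<in>boxes lam. f (Suc i) j)"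
proof -
  have pos: "(i, j) \<in> boxes lam \<Longrightarrow> i \<ge> 1" for i j by (auto simp: boxes_def)
  have "boxes (a # lam) = Pair 1 ` {1..a} \<union> (\<lambda>(i, j). (Suc i, j)) ` boxes lam" (is "_ = ?P \<union> ?Q")
  proof (rule set_eqI, clarify)
    fix i j
    show "(i, j) \<in> boxes (a # lam) \<longleftrightarrow> (i, j) \<in> ?P \<union> ?Q"
      unfolding mem_boxes_Cons using pos by (cases i) (auto simp: image_iff Suc_le_eq split: prod.splits)
  qed
  moreover have "?P \<inter> ?Q = {}" using pos by fastforce
  ultimately have "(\<Sum>(i, j)\<in>boxes (a # lam). f i j) = (\<Sum>(i, j)\<in>?P. f i j) + (\<Sum>(i, j)\<in>?Q. f i j)"
    by (simp add: sum.union_disjoint finite_boxes)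
  also have "(\<Sum>(i, j)\<in>?P. f i j) = (\<Sum>j=1..a. f 1 j)"
    by (subst sum.reindex) (auto simp: inj_on_def)
  also have "(\<Sum>(i, j)\<in>?Q. f i j) = (\<Sum>(i, j)\<in>boxes lam. f (Suc i) j)"
    by (subst sum.reindex) (auto simp: inj_on_def case_prod_unfold)
  finally show ?thesis .
qed

lemma card_boxes: "card (boxes lam) = sum_list lam"
proof -
  have "(\<Sum>(i, j)\<in>boxes lam. 1 :: real) = real (sum_list lam)"
  proof (induction lam)
    case (Cons a lam)
    then show ?case by (subst sum_boxes_Cons) simp
  qed (simp add: boxes_Nil)
  then show ?thesis by simp
qed

lemma conj_part_Cons: "conj_part (a # lam) j = (if j \<le> a then 1 else 0) + conj_part lam j"
proof -
  have "{k. 1 \<le> k \<and> k \<le> length (a # lam) \<and> part (a # lam) k \<ge> j} =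
      (if j \<le> a then {1} else {}) \<union> Suc ` {k. 1 \<le> k \<and> k \<le> length lam \<and> part lam k \<ge> j}" (is "?X = ?Y \<union> Suc ` ?Z")
  proof (rule set_eqI)
    fix k show "k \<in> ?X \<longleftrightarrow> k \<in> ?Y \<union> Suc ` ?Z"
      by (cases k; cases "k - 1") (auto simp: part_def image_iff)
  qed
  moreover have "?Y \<inter> Suc ` ?Z = {}" by auto
  moreover have "finite ?Z" by simp
  ultimately show ?thesis unfolding conj_part_def
    by (simp add: card_Un_disjoint card_image)
qed

text \<open>For weakly decreasing parts each column is an initial segment of the rows, hence
  determined by its length. This gives the transposed view without constructing the conjugate
  partition.\<close>

lemma mem_boxes_conj_part:
  assumes "sorted_wrt (\<ge>) lam"
  shows "(i, j) \<in> boxes lam \<longleftrightarrow> 1 \<le> i \<and> 1 \<le> j \<and> i \<le> conj_part lam j"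
  using assms
proof (induction lam arbitrary: i)
  case Nil
  have "conj_part [] j = 0" by (auto simp: conj_part_def card_eq_0_iff)
  then show ?case by (simp add: boxes_Nil)
next
  case (Cons a lam)
  show ?case
  proof (cases "j \<le> a")
    case True
    then show ?thesis using Cons by (auto simp: mem_boxes_Cons conj_part_Cons)
  next
    case False
    \<comment> \<open>All later parts are at most \<open>a\<close>, hence less than
      \<open>j\<close>.\<close>
    then have "(i', j) \<notin> boxes lam" for i'
      using Cons.prems by (auto simp: boxes_def part_def set_conv_nth)
        (metis One_nat_def Suc_le_eq diff_Suc_1 le_trans less_imp_diff_less Suc_pred' not_gr_zero zero_less_one not_less_eq_eq)
    then show ?thesis using Cons False
      by (auto simp: mem_boxes_Cons conj_part_Cons)
  qed
qed

text \<open>The bound \<open>a\<close> may exceed the number of columns, so the first part of a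
  longer partition can be used for its remaining rows.\<close>

lemma sum_boxes_columns:
  assumes "sorted_wrt (\<ge>) lam" "\<And>j. conj_part lam j > 0 \<Longrightarrow> 1 \<le> j \<Longrightarrow> j \<le> a"
  shows "(\<Sum>(i, j)\<in>boxes lam. f i j :: real) = (\<Sum>j=1..a. \<Sum>i=1..conj_part lam j. f i j)"
proof -
  have "(\<Sum>(i, j)\<in>boxes lam. f i j) = (\<Sum>(j, i)\<in>(SIGMA j:{1..a}. {1..conj_part lam j}). f i j)"
    by (rule sum.reindex_bij_witness[of _ prod.swap prod.swap])
      (use assms in \<open>auto simp: mem_boxes_conj_part\<close>)
  also have "\<dots> = (\<Sum>j=1..a. \<Sum>i=1..conj_part lam j. f i j)"
    by (rule sum.Sigma[symmetric]) auto
  finally show ?thesis .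
qed

lemma conj_part_pos_le:
  assumes "sorted_wrt (\<ge>) (a # lam)" "conj_part lam j > 0"
  shows "j \<le> a"
proof -
  have "{k. 1 \<le> k \<and> k \<le> length lam \<and> part lam k \<ge> j} \<noteq> {}"
    using assms(2) unfolding conj_part_def by (metis card.empty less_irrefl)
  then obtain k where "1 \<le> k" "k \<le> length lam" "part lam k \<ge> j" by blast
  moreover from this have "part lam k \<in> set lam" by (simp add: part_def)
  ultimately show ?thesis using assms(1) by fastforce
qed

section \<open>Arms, legs and squared hook lengths\<close>

lemma arm_nonneg: "(i, j) \<in> boxes lam \<Longrightarrow> j \<le> part lam i"
  by (simp add: boxes_def)

lemma leg_nonneg: "sorted_wrt (\<ge>) lam \<Longrightarrow> (i, j) \<in> boxes lam \<Longrightarrow> i \<le> conj_part lam j"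
  by (simp add: mem_boxes_conj_part)

text \<open>Reversing each row turns the arm length into \<open>j - 1\<close>; reversing each column
  does the same for legs in \<open>sum_leg\<close>.\<close>

lemma sum_arm:
  "(\<Sum>(i, j)\<in>boxes lam. f (real (part lam i) - real j)) = (\<Sum>(i, j)\<in>boxes lam. f (real j - 1) :: real)"
  by (rule sum.reindex_bij_witness[of _ "\<lambda>(i, j). (i, part lam i + 1 - j)" "\<lambda>(i, j). (i, part lam i + 1 - j)"])
    (auto simp: boxes_def of_nat_diff)

lemma sum_leg:
  assumes "sorted_wrt (\<ge>) lam"
  shows "(\<Sum>(i, j)\<in>boxes lam. f (real (conj_part lam j) - real i)) = (\<Sum>(i, j)\<in>boxes lam. f (real i - 1) :: real)"
  by (rule sum.reindex_bij_witness[of _ "\<lambda>(i, j). (conj_part lam j + 1 - i, j)" "\<lambda>(i, j). (conj_part lam j + 1 - i, j)"])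
    (auto simp: mem_boxes_conj_part[OF assms] of_nat_diff)

text \<open>This counts pairs of boxes: twice the product of arm and leg counts the pairs in which one box
  is strictly south-west of the other, and \<open>2 i j - 1\<close> is the number of ordered pairs that consist
  of \<open>(i, j)\<close> and a box weakly north-west of it.\<close>

lemma sum_arm_leg:
  assumes "sorted_wrt (\<ge>) lam"
  shows "(\<Sum>(i, j)\<in>boxes lam. 2 * (real (part lam i) - real j) * (real (conj_part lam j) - real i)
            + 2 * real i * real j - 1) = real (sum_list lam) ^ 2"
  using assms
proof (induction lam)
  case Nil
  then show ?case by (simp add: boxes_Nil)
next
  case (Cons a lam)
  let ?m = "real (sum_list lam)" and ?c = "conj_part lam"
  let ?t = "\<lambda>i j. 2 * (real (part lam i) - real j) * (real (?c j) - real i) + 2 * real i * real j - 1"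
  have sorted: "sorted_wrt (\<ge>) lam" using Cons.prems by simp
  have le: "j \<le> a" if "(i, j) \<in> boxes lam" for i j
    using that conj_part_pos_le[OF Cons.prems, of j] by (simp add: mem_boxes_conj_part[OF sorted])
  have part1: "part (a # lam) 1 = a" by (simp add: part_def)
  have partS: "part (a # lam) (Suc i) = part lam i" if "(i, j) \<in> boxes lam" for i j
    using that by (cases i) (auto simp: part_def boxes_def)
  \<comment> \<open>In the first row the leg at column \<open>j\<close> is the full column length
    \<open>?c j\<close> of the remaining rows.\<close>
  have "(\<Sum>j=1..a. 2 * (real (part (a # lam) 1) - real j) * (real (conj_part (a # lam) j) - real 1) + 2 * real 1 * real j - 1)
      = (\<Sum>j=1..a. 2 * ((real a - real j) * real (?c j)) + (2 * real j - 1))"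
    by (rule sum.cong) (simp_all add: part1[simplified] conj_part_Cons)
  also have "\<dots> = 2 * (\<Sum>j=1..a. (real a - real j) * real (?c j)) + (\<Sum>j=1..a. 2 * real j - 1)"
    by (simp add: sum.distrib sum_distrib_left)
  also have "(\<Sum>j=1..a. 2 * real j - 1) = real a ^ 2"
    by (induction a) (auto simp: power2_eq_square algebra_simps)
  also have "(\<Sum>j=1..a. (real a - real j) * real (?c j)) = (\<Sum>(i, j)\<in>boxes lam. real a - real j)"
    using conj_part_pos_le[OF Cons.prems] by (subst sum_boxes_columns[OF sorted, of a]) (auto simp: mult.commute)
  finally have row: "(\<Sum>j=1..a. 2 * (real (part (a # lam) 1) - real j) * (real (conj_part (a # lam) j) - real 1) + 2 * real 1 * real j - 1)
      = 2 * (\<Sum>(i, j)\<in>boxes lam. real a - real j) + real a ^ 2" .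
  \<comment> \<open>Prepending a row leaves arms and legs of the old boxes unchanged, as row index
    and column length both grow by one. Only the term \<open>2 * i * j\<close> grows, by
    \<open>2 * j\<close>.\<close>
  have "(\<Sum>(i, j)\<in>boxes lam. 2 * (real (part (a # lam) (Suc i)) - real j) * (real (conj_part (a # lam) j) - real (Suc i)) + 2 * real (Suc i) * real j - 1)
      = (\<Sum>(i, j)\<in>boxes lam. ?t i j + 2 * real j)"
    by (rule sum.cong) (auto simp: partS le conj_part_Cons algebra_simps)
  also have "\<dots> = ?m ^ 2 + (\<Sum>(i, j)\<in>boxes lam. 2 * real j)"
    using Cons.IH[OF sorted] by (simp add: case_prod_unfold sum.distrib)
  finally have rest: "(\<Sum>(i, j)\<in>boxes lam. 2 * (real (part (a # lam) (Suc i)) - real j) * (real (conj_part (a # lam) j) - real (Suc i)) + 2 * real (Suc i) * real j - 1)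
      = ?m ^ 2 + (\<Sum>(i, j)\<in>boxes lam. 2 * real j)" .
  \<comment> \<open>The terms in \<open>j\<close> cancel, leaving the cross term of the square of
    \<open>real a + ?m\<close>.\<close>
  have "2 * (\<Sum>(i, j)\<in>boxes lam. real a - real j) + (\<Sum>(i, j)\<in>boxes lam. 2 * real j) = 2 * real a * ?m"
    by (simp add: case_prod_unfold sum_subtractf sum_distrib_left card_boxes algebra_simps)
  then show ?case
    unfolding sum_boxes_Cons row rest by (simp add: power2_eq_square algebra_simps)
qed

text \<open>The hook is arm plus leg plus one; its square is grouped into a part in the arm alone, a
  part in the leg alone, and the mixed part handled by \<open>sum_arm_leg\<close>.\<close>

lemma sum_hook_square:
  assumes "sorted_wrt (\<ge>) lam"
  shows "(\<Sum>v\<in>boxes lam. real (hook lam v) ^ 2) = real (sum_list lam) ^ 2 + (\<Sum>v\<in>boxes lam. content v ^ 2)"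
proof -
  let ?a = "\<lambda>i j. real (part lam i) - real j" and ?l = "\<lambda>i j. real (conj_part lam j) - real i"
  let ?S = "\<lambda>f. \<Sum>(i, j)\<in>boxes lam. f i j :: real"
  have "(\<Sum>v\<in>boxes lam. real (hook lam v) ^ 2) = ?S (\<lambda>i j. (?a i j + ?l i j + 1) ^ 2)"
    by (rule sum.cong) (auto simp: hook_def of_nat_diff[OF arm_nonneg] of_nat_diff[OF leg_nonneg[OF assms]] add_ac simp del: of_nat_diff)
  also have "\<dots> = ?S (\<lambda>i j. (?a i j ^ 2 + 2 * ?a i j) + (?l i j ^ 2 + 2 * ?l i j) + (2 * ?a i j * ?l i j + 1))"
    by (rule sum.cong) (auto simp: power2_eq_square algebra_simps)
  also have "\<dots> = ?S (\<lambda>i j. ?a i j ^ 2 + 2 * ?a i j) + ?S (\<lambda>i j. ?l i j ^ 2 + 2 * ?l i j)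
      + ?S (\<lambda>i j. 2 * ?a i j * ?l i j + 1)"
    by (simp only: case_prod_unfold sum.distrib)
  also have "?S (\<lambda>i j. ?a i j ^ 2 + 2 * ?a i j) = ?S (\<lambda>i j. (real j - 1) ^ 2 + 2 * (real j - 1))"
    by (rule sum_arm)
  also have "?S (\<lambda>i j. ?l i j ^ 2 + 2 * ?l i j) = ?S (\<lambda>i j. (real i - 1) ^ 2 + 2 * (real i - 1))"
    by (rule sum_leg[OF assms])
  \<comment> \<open>The first two summands are \<open>j^2 - 1\<close> and \<open>i^2 - 1\<close>;
    moving \<open>2 * i * j\<close> into the mixed part leaves the squared content.\<close>
  also have "?S (\<lambda>i j. (real j - 1) ^ 2 + 2 * (real j - 1)) + ?S (\<lambda>i j. (real i - 1) ^ 2 + 2 * (real i - 1))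
      + ?S (\<lambda>i j. 2 * ?a i j * ?l i j + 1) =
      ?S (\<lambda>i j. 2 * ?a i j * ?l i j + 2 * real i * real j - 1) + ?S (\<lambda>i j. content (i, j) ^ 2)"
    unfolding case_prod_unfold sum.distrib[symmetric]
    by (rule sum.cong) (auto simp: content_def power2_eq_square algebra_simps)
  finally show ?thesis
    by (simp only: sum_arm_leg[OF assms]) (simp add: case_prod_unfold)
qed

section \<open>Partitions and diagrams\<close>

lemma initial_segment_eq:
  assumes "finite A" "\<And>x. x \<in> A \<Longrightarrow> 1 \<le> x" "\<And>x y. x \<in> A \<Longrightarrow> 1 \<le> y \<Longrightarrow> y \<le> x \<Longrightarrow> y \<in> A"
  shows "A = {1..card A :: nat}"
proof (cases "A = {}")
  case False
  have "A = {1..Max A}"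
    using assms(2) Max_ge[OF assms(1)] assms(3)[OF Max_in[OF assms(1) False]]
    unfolding set_eq_iff atLeastAtMost_iff by blast
  then show ?thesis by (metis card_atLeastAtMost diff_Suc_1)
qed simp

lemma diagram_boxes:
  assumes "sorted_wrt (\<ge>) lam"
  shows "diagram (boxes lam)"
proof (rule diagramI)
  fix i j i' j' assume ij: "(i, j) \<in> boxes lam" and le: "1 \<le> i'" "i' \<le> i" "1 \<le> j'" "j' \<le> j"
  then have "(i', j) \<in> boxes lam" by (simp add: mem_boxes_conj_part[OF assms])
  then show "(i', j') \<in> boxes lam" using le by (simp add: boxes_def)
qed (use finite_boxes in \<open>auto simp: boxes_def\<close>)

lemma inj_on_boxes: "inj_on boxes {lam. is_partition n lam}"
proof (rule inj_onI)
  have row: "{j. (i, j) \<in> boxes lam} = (if 1 \<le> i \<and> i \<le> length lam then {1..part lam i} else {})"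
    for i lam by (auto simp: boxes_def)
  \<comment> \<open>Positivity of the parts makes every row meet the first column, so the number of
    parts can be read off.\<close>
  have rows: "{i. (i, 1) \<in> boxes lam} = {1..length lam}" if "is_partition n lam" for lam
    using that by (fastforce simp: boxes_def is_partition_def part_def Suc_le_eq)
  fix lam mu assume "lam \<in> {lam. is_partition n lam}" "mu \<in> {lam. is_partition n lam}"
    and eq: "boxes lam = boxes mu"
  then have len: "length lam = length mu"
    using rows[of lam] rows[of mu] by (metis card_atLeastAtMost diff_Suc_1 mem_Collect_eq)
  show "lam = mu"
  proof (rule nth_equalityI[OF len])
    fix i assume "i < length lam"
    then have "{j. (Suc i, j) \<in> boxes lam} = {1..part lam (Suc i)}"
      "{j. (Suc i, j) \<in> boxes mu} = {1..part mu (Suc i)}"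
      using row len by simp_all
    then have "{1..part lam (Suc i)} = {1..part mu (Suc i)}" unfolding eq by (rule trans[OF sym])
    then have "part lam (Suc i) = part mu (Suc i)" by (metis card_atLeastAtMost diff_Suc_1)
    then show "lam ! i = mu ! i" by (simp add: part_def)
  qed
qed

text \<open>The parts are the row lengths, taken only for the rows that meet the first column, so
  none is zero.\<close>

lemma diagram_eq_boxes:
  assumes S: "diagram S"
  obtains lam where "sorted_wrt (\<ge>) lam" "\<forall>p\<in>set lam. p > 0" "boxes lam = S"
proof -
  define row where "row i = card {j. (i, j) \<in> S}" for i
  define l where "l = card {i. (i, 1) \<in> S}"
  define lam where "lam = map (\<lambda>k. row (Suc k)) [0..<l]"
  have "finite {j. (i, j) \<in> S}" for i
    by (rule finite_subset[of _ "snd ` S"]) (simp_all add: diagram_finite[OF S] subset_iff rev_image_eqI)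
  then have "{j. (i, j) \<in> S} = {1..row i}" for i
    unfolding row_def using diagram_pos[OF S] diagram_down[OF S, of i _ i]
    by (intro initial_segment_eq) auto
  then have row: "(i, j) \<in> S \<longleftrightarrow> 1 \<le> j \<and> j \<le> row i" for i j by (auto simp: set_eq_iff)
  have "finite {i. (i, 1) \<in> S}"
    by (rule finite_subset[of _ "fst ` S"]) (simp_all add: diagram_finite[OF S] subset_iff rev_image_eqI)
  then have "{i. (i, 1) \<in> S} = {1..l}"
    unfolding l_def using diagram_pos[OF S] diagram_down[OF S, of _ 1 _ 1]
    by (intro initial_segment_eq) auto
  then have l: "(i, 1) \<in> S \<longleftrightarrow> 1 \<le> i \<and> i \<le> l" for i by (auto simp: set_eq_iff)
  have part: "part lam i = row i" if "1 \<le> i" "i \<le> l" for i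
    using that by (cases i) (simp_all add: part_def lam_def)
  have "(i, j) \<in> boxes lam \<longleftrightarrow> (i, j) \<in> S" for i j
  proof -
    have "1 \<le> i \<and> i \<le> l" if "(i, j) \<in> S"
      using l[of i] diagram_down[OF S that, of i 1] diagram_pos[OF S that] by simp
    moreover have "length lam = l" by (simp add: lam_def)
    ultimately show ?thesis using row part by (auto simp: boxes_def)
  qed
  then have "boxes lam = S" by auto
  moreover have "row (Suc k) > 0" if "k < l" for k
    using l[of "Suc k"] row[of "Suc k" 1] that by simp
  then have "\<forall>p\<in>set lam. p > 0" by (auto simp: lam_def)
  moreover have "row i' \<le> row i" if "1 \<le> i" "i \<le> i'" for i i'
    using row[of i' "row i'"] row[of i "row i'"] diagram_down[OF S, of i' "row i'" i "row i'"] that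
    by (cases "row i' = 0") auto
  then have "sorted_wrt (\<ge>) lam" by (auto simp: lam_def sorted_wrt_map sorted_wrt_iff_nth_less)
  ultimately show ?thesis using that by blast
qed

lemma bij_betw_boxes: "bij_betw boxes {lam. is_partition n lam} (diagrams n)"
proof (rule bij_betw_imageI[OF inj_on_boxes], intro equalityI subsetI)
  fix S assume S: "S \<in> diagrams n"
  then obtain lam where "sorted_wrt (\<ge>) lam" "\<forall>p\<in>set lam. p > 0" "boxes lam = S"
    using diagram_eq_boxes[of S] by (auto simp: diagrams_def)
  moreover from this have "is_partition n lam"
    using S card_boxes[of lam] by (simp add: is_partition_def diagrams_def)
  ultimately show "S \<in> boxes ` {lam. is_partition n lam}" by blast
qed (auto simp: is_partition_def diagrams_def card_boxes diagram_boxes)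

lemma num_SYT_eq: "real (num_SYT lam) = num_tableaux (boxes lam)"
  by (simp add: num_SYT_def num_tableaux_def standard_tableaux_def tableaux_def card_boxes)

theorem theorem6p10:
  fixes n :: nat
  assumes "n \<ge> 1"
  shows "(\<Sum>lam \<in> {lam. is_partition n lam}.
            real (num_SYT lam) ^ 2 * (\<Sum>v \<in> boxes lam. real (hook lam v) ^ 2))
         = real n * (3 * real n - 1) / 2 * fact n"
proof -
  have "(\<Sum>lam \<in> {lam. is_partition n lam}.
            real (num_SYT lam) ^ 2 * (\<Sum>v \<in> boxes lam. real (hook lam v) ^ 2)) =
      (\<Sum>lam \<in> {lam. is_partition n lam}. real n ^ 2 * num_tableaux (boxes lam) ^ 2
            + num_tableaux (boxes lam) ^ 2 * (\<Sum>v \<in> boxes lam. content v ^ 2))"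
    by (rule sum.cong) (auto simp: is_partition_def sum_hook_square num_SYT_eq algebra_simps)
  also have "\<dots> = (\<Sum>S\<in>diagrams n. real n ^ 2 * num_tableaux S ^ 2
            + num_tableaux S ^ 2 * (\<Sum>v\<in>S. content v ^ 2))"
    by (rule sum.reindex_bij_betw[OF bij_betw_boxes])
  also have "\<dots> = real n ^ 2 * fact n + real n * (real n - 1) / 2 * fact n"
    by (simp only: sum.distrib sum_distrib_left[symmetric] sum_num_tableaux_square sum_content_square)
  also have "\<dots> = real n * (3 * real n - 1) / 2 * fact n"
    by (simp add: power2_eq_square field_simps)
  finally show ?thesis .
qed

end
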